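(* Let $G$ be any finite simple graph on $n\geq 2$ vertices other than the path on $4$ vertices, and let $G^c$ be its complement. Then $\max\{h(G),h(G^c)\}\geq \frac{1}{\lfloor n/2\rfloor}$.
   Context: For a graph $G=(V,E)$ and $X\subseteq V$ write $\bar X=V\setminus X$ and $\partial_G(X)$ for the set of edges of $G$ with one endpoint in $X$ and the other in $\bar X$. The volume of $X$ is $\mathrm{vol}_G(X)=\sum_{x\in X}\deg_G(x)$. The Cheeger ratio of a nonempty proper subset $X$ (with positive denominator) is $h_G(X)=\frac{|\partial_G(X)|}{\min\{\mathrm{vol}_G(X),\mathrm{vol}_G(\bar X)\}}$, and the Cheeger constant is $h(G)=\min_X h_G(X)$, the minimum over nonempty proper subsets $X\subset V$ for which $h_G(X)$ is defined. The complement $G^c$ has vertex set $V$ and contains exactly the pairs of distinct vertices that are not edges of $G$. *)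

theory Defs
  imports Complex_Main
begin

text \<open>A graph is given by a vertex set \<open>V\<close> and a set \<open>E\<close> of unordered edges, each edge being
  the two-element set of its endpoints.\<close>

definition finite_simple_graph :: "'a set \<Rightarrow> 'a set set \<Rightarrow> bool" where
  "finite_simple_graph V E \<longleftrightarrow>
     finite V \<and> (\<forall>e\<in>E. \<exists>u\<in>V. \<exists>v\<in>V. u \<noteq> v \<and> e = {u, v})"

definition complement_edges :: "'a set \<Rightarrow> 'a set set \<Rightarrow> 'a set set" where
  "complement_edges V E = {{u, v} |u v. u \<in> V \<and> v \<in> V \<and> u \<noteq> v \<and> {u, v} \<notin> E}"

definition graph_isomorphic ::
  "'a set \<Rightarrow> 'a set set \<Rightarrow> 'b set \<Rightarrow> 'b set set \<Rightarrow> bool" where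
  "graph_isomorphic V E V' E' \<longleftrightarrow>
     (\<exists>f. bij_betw f V V' \<and> (\<forall>u\<in>V. \<forall>v\<in>V. {u, v} \<in> E \<longleftrightarrow> {f u, f v} \<in> E'))"

definition path_vertices :: "nat \<Rightarrow> nat set" where
  "path_vertices k = {0..<k}"

definition path_edges :: "nat \<Rightarrow> nat set set" where
  "path_edges k = {{i, Suc i} |i. Suc i < k}"

definition degree :: "'a set set \<Rightarrow> 'a \<Rightarrow> nat" where
  "degree E v = card {e \<in> E. v \<in> e}"

definition vol :: "'a set set \<Rightarrow> 'a set \<Rightarrow> nat" where
  "vol E X = (\<Sum>x\<in>X. degree E x)"

definition edge_boundary :: "'a set \<Rightarrow> 'a set set \<Rightarrow> 'a set \<Rightarrow> 'a set set" where
  "edge_boundary V E X = {e \<in> E. \<exists>x\<in>X. \<exists>y\<in>V - X. e = {x, y}}"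

definition cheeger_admissible :: "'a set \<Rightarrow> 'a set set \<Rightarrow> 'a set set" where
  "cheeger_admissible V E =
     {X. X \<noteq> {} \<and> X \<subset> V \<and> 0 < min (vol E X) (vol E (V - X))}"

definition cheeger_ratio :: "'a set \<Rightarrow> 'a set set \<Rightarrow> 'a set \<Rightarrow> real" where
  "cheeger_ratio V E X =
     real (card (edge_boundary V E X)) / real (min (vol E X) (vol E (V - X)))"

text \<open>The minimum ranges over the empty set exactly when the graph has no edges. The value \<open>0\<close>
  in that case is a convention: Cheeger ratios are nonnegative, so an edgeless graph never
  contributes to the maximum of its own Cheeger constant and that of its complement.\<close>

definition cheeger_constant :: "'a set \<Rightarrow> 'a set set \<Rightarrow> real" where
  "cheeger_constant V E =
     (if cheeger_admissible V E = {} then 0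
      else Min (cheeger_ratio V E ` cheeger_admissible V E))"

end

theory Submission
  imports Defs
begin

text \<open>Put \<open>m = \<lfloor>n/2\<rfloor>\<close> and suppose that both Cheeger constants are below \<open>1/m\<close>. Since
  \<open>vol X \<le> |X| (|X| - 1) + |\<partial>X|\<close>, there are sets \<open>X\<close>, \<open>Y\<close> of size between \<open>2\<close> and \<open>m\<close> with
  \<open>|\<partial>X| (m - 1) < |X| (|X| - 1)\<close> in \<open>G\<close> and likewise for \<open>Y\<close> in the complement. A pair of vertices
  lying in opposite quadrants of the partition generated by \<open>X\<close> and \<open>Y\<close> is separated by both sets,
  so it is a boundary edge of \<open>X\<close> in \<open>G\<close> or of \<open>Y\<close> in the complement. Counting these pairs
  contradicts the two bounds unless \<open>n = 4\<close> and \<open>|\<partial>X| = 1\<close>, and then \<open>G\<close> is the path on four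
  vertices.\<close>

section \<open>Edges, boundaries and volumes\<close>

lemma finite_simple_graph_edges:
  assumes "finite_simple_graph V E"
  shows "finite V" and "finite E" and "\<And>e. e \<in> E \<Longrightarrow> e \<subseteq> V \<and> card e = 2"
proof -
  show fin: "finite V" using assms by (simp add: finite_simple_graph_def)
  show sub: "e \<subseteq> V \<and> card e = 2" if "e \<in> E" for e
    using assms that by (fastforce simp: finite_simple_graph_def)
  then have "E \<subseteq> Pow V" by blast
  then show "finite E" using fin finite_subset by blast
qed

lemma finite_simple_graph_complement:
  assumes "finite_simple_graph V E"
  shows "finite_simple_graph V (complement_edges V E)"
  using assms unfolding finite_simple_graph_def complement_edges_def by blast

lemma edge_boundary_Diff:
  assumes "X \<subseteq> V"
  shows "edge_boundary V E (V - X) = edge_boundary V E X"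
proof -
  have "V - (V - X) = X" using assms by blast
  then show ?thesis unfolding edge_boundary_def by (metis insert_commute)
qed

lemma card_inter_edge:
  assumes "finite_simple_graph V E" and "X \<subseteq> V" and "e \<in> E"
  shows "card (e \<inter> X) = (if e \<subseteq> X then 2 else 0) + (if e \<in> edge_boundary V E X then 1 else 0)"
proof -
  obtain u v where uv: "u \<in> V" "v \<in> V" "u \<noteq> v" "e = {u, v}"
    using assms by (auto simp: finite_simple_graph_def)
  have "e \<in> edge_boundary V E X \<longleftrightarrow> (u \<in> X \<and> v \<notin> X) \<or> (v \<in> X \<and> u \<notin> X)"
    using uv assms(3) by (auto simp: edge_boundary_def doubleton_eq_iff)
  then show ?thesis using uv by (cases "u \<in> X"; cases "v \<in> X") auto
qed

text \<open>Double counting of incidences between \<open>X\<close> and \<open>E\<close>: an edge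
  inside \<open>X\<close> contributes two, a boundary edge one, any other edge none.\<close>

lemma vol_eq:
  assumes G: "finite_simple_graph V E" and X: "X \<subseteq> V"
  shows "vol E X = 2 * card {e \<in> E. e \<subseteq> X} + card (edge_boundary V E X)"
proof -
  note fin = finite_simple_graph_edges[OF G]
  have finX: "finite X" using fin(1) X finite_subset by blast
  have "vol E X = (\<Sum>x\<in>X. \<Sum>e\<in>E. if x \<in> e then 1 else 0)"
    unfolding vol_def degree_def using fin(2) by (simp add: sum.If_cases Int_def)
  also have "\<dots> = (\<Sum>e\<in>E. \<Sum>x\<in>X. if x \<in> e then 1 else 0)" by (rule sum.swap)
  also have "\<dots> = (\<Sum>e\<in>E. card (e \<inter> X))"
    using finX by (simp add: sum.If_cases Int_def conj_commute)
  also have "\<dots> = (\<Sum>e\<in>E. (if e \<subseteq> X then 2 else 0) + (if e \<in> edge_boundary V E X then 1 else 0))"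
    by (intro sum.cong refl card_inter_edge[OF G X])
  also have "\<dots> = 2 * card {e \<in> E. e \<subseteq> X} + card (E \<inter> edge_boundary V E X)"
    using fin(2) by (simp add: sum.distrib sum.If_cases Int_def)
  also have "E \<inter> edge_boundary V E X = edge_boundary V E X"
    by (auto simp: edge_boundary_def)
  finally show ?thesis .
qed

lemma card_inner_edges_le:
  assumes G: "finite_simple_graph V E" and X: "X \<subseteq> V"
  shows "2 * card {e \<in> E. e \<subseteq> X} \<le> card X * (card X - 1)"
proof -
  note fin = finite_simple_graph_edges[OF G]
  have finX: "finite X" using fin(1) X finite_subset by blast
  have "{e \<in> E. e \<subseteq> X} \<subseteq> {e. e \<subseteq> X \<and> card e = 2}" using fin(3) by blast
  then have "card {e \<in> E. e \<subseteq> X} \<le> card X choose 2"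
    using card_mono[of "{e. e \<subseteq> X \<and> card e = 2}"] n_subsets[OF finX, of 2] finX by simp
  moreover have "2 * (card X choose 2) = card X * (card X - 1)"
    by (cases "card X") (auto simp: choose_two)
  ultimately show ?thesis by linarith
qed

section \<open>Sets of small Cheeger ratio\<close>

text \<open>For an edge \<open>{u, v}\<close> the singleton \<open>{u}\<close> is admissible, since
  \<open>v\<close> keeps the volume of the rest positive. So the default value \<open>0\<close> of
  \<open>cheeger_constant\<close> concerns edgeless graphs only.\<close>

lemma cheeger_admissible_ne:
  assumes G: "finite_simple_graph V E" and "E \<noteq> {}"
  shows "cheeger_admissible V E \<noteq> {}"
proof -
  note fin = finite_simple_graph_edges[OF G]
  obtain u v where uv: "u \<in> V" "v \<in> V" "u \<noteq> v" "{u, v} \<in> E"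
    using assms by (auto simp: finite_simple_graph_def) (metis)
  have "degree E u > 0" "degree E v > 0"
    using uv fin(2) by (auto simp: degree_def card_gt_0_iff)
  moreover have "degree E v \<le> vol E (V - {u})"
    unfolding vol_def using uv fin(1) by (intro member_le_sum) auto
  ultimately have "{u} \<in> cheeger_admissible V E"
    using uv by (auto simp: cheeger_admissible_def vol_def)
  then show ?thesis by blast
qed

text \<open>A minimizer of the ratio serves, or its complement if it has more than \<open>m\<close>
  elements: both have the same boundary and the same pair of volumes.\<close>

lemma cheeger_constant_less_obtains:
  assumes G: "finite_simple_graph V E" and ne: "E \<noteq> {}"
    and less: "cheeger_constant V E < 1 / real m" and m: "m > 0" and n: "card V \<le> 2 * m + 1"
  obtains X where "X \<subseteq> V" "card X \<le> m"
    "m * card (edge_boundary V E X) < vol E X" "m * card (edge_boundary V E X) < vol E (V - X)"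
proof -
  note fin = finite_simple_graph_edges[OF G]
  have "cheeger_admissible V E \<subseteq> Pow V" by (auto simp: cheeger_admissible_def)
  then have fA: "finite (cheeger_admissible V E)" using fin(1) finite_subset by blast
  have "Min (cheeger_ratio V E ` cheeger_admissible V E) \<in> cheeger_ratio V E ` cheeger_admissible V E"
    using fA cheeger_admissible_ne[OF G ne] by (intro Min_in) auto
  then obtain X where X: "X \<in> cheeger_admissible V E" "cheeger_ratio V E X < 1 / real m"
    using less cheeger_admissible_ne[OF G ne] by (auto simp: cheeger_constant_def)
  let ?b = "card (edge_boundary V E X)" and ?v = "min (vol E X) (vol E (V - X))"
  have v: "?v > 0" and XV: "X \<subseteq> V" using X(1) by (auto simp: cheeger_admissible_def)
  have "real ?b / real ?v < 1 / real m" using X(2) by (simp only: cheeger_ratio_def)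
  then have "real m * real ?b < real ?v" using v m by (simp add: field_simps del: of_nat_min)
  then have "real (m * ?b) < real ?v" by (simp del: of_nat_min)
  then have lt: "m * ?b < ?v" by (simp only: of_nat_less_iff)
  show ?thesis
  proof (cases "card X \<le> m")
    case True
    then show ?thesis using that[of X] XV lt by simp
  next
    case False
    have "card (V - X) = card V - card X"
      using XV fin(1) by (meson card_Diff_subset finite_subset)
    then have "card (V - X) \<le> m" using False n by linarith
    moreover have "V - (V - X) = X" using XV by blast
    ultimately show ?thesis using that[of "V - X"] edge_boundary_Diff[OF XV, of E] lt by simp
  qed
qed

text \<open>Bounding the inner part of the volume by \<open>card X * (card X - 1)\<close> and
  cancelling one copy of the boundary size gives the inequality. Its right side vanishes for sizes 0
  and 1, which forces size at least 2.\<close>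

lemma small_boundary_bound:
  assumes G: "finite_simple_graph V E" and XV: "X \<subseteq> V" and m: "m > 0"
    and lt: "m * card (edge_boundary V E X) < vol E X"
  shows "2 \<le> card X" and "(m - 1) * card (edge_boundary V E X) < card X * (card X - 1)"
proof -
  let ?b = "card (edge_boundary V E X)"
  have "m * ?b < card X * (card X - 1) + ?b"
    using lt vol_eq[OF G XV] card_inner_edges_le[OF G XV] by linarith
  moreover have "m * ?b = (m - 1) * ?b + ?b" using m by (cases m) auto
  ultimately show *: "(m - 1) * ?b < card X * (card X - 1)" by linarith
  show "2 \<le> card X"
  proof (rule ccontr)
    assume "\<not> 2 \<le> card X"
    then have "card X = 0 \<or> card X = 1" by linarith
    then show False using * by auto
  qed
qed

text \<open>The last conclusion is restricted to nonempty boundaries so that the statement covers edgeless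
  graphs too, where any set of size \<open>m\<close> serves as \<open>X\<close>.\<close>

lemma small_cheeger_constant_obtains:
  assumes G: "finite_simple_graph V E"
    and less: "cheeger_constant V E < 1 / real m" and m: "m = card V div 2" "m \<ge> 2"
  obtains X where "X \<subseteq> V" "2 \<le> card X" "card X \<le> m"
    "(m - 1) * card (edge_boundary V E X) < card X * (card X - 1)"
    "card (edge_boundary V E X) > 0 \<Longrightarrow>
       m * card (edge_boundary V E X) < vol E X \<and> m * card (edge_boundary V E X) < vol E (V - X)"
proof (cases "E = {}")
  case True
  obtain X where "X \<subseteq> V" "card X = m"
    using m(1) by (metis div_le_dividend obtain_subset_with_card_n)
  then show ?thesis using that[of X] m(2) True by (simp add: edge_boundary_def)
next
  case False
  have n: "card V \<le> 2 * m + 1" "m > 0" using m by auto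
  obtain X where X: "X \<subseteq> V" "card X \<le> m"
    "m * card (edge_boundary V E X) < vol E X" "m * card (edge_boundary V E X) < vol E (V - X)"
    using cheeger_constant_less_obtains[OF G False less n(2,1)] by blast
  then show ?thesis using that[of X] small_boundary_bound[OF G X(1) _ X(3)] m(2) by simp
qed

section \<open>Counting pairs in opposite quadrants\<close>

lemma opposite_quadrants_le:
  assumes G: "finite_simple_graph V E" and XV: "X \<subseteq> V" and YV: "Y \<subseteq> V"
  shows "card (X \<inter> Y) * card (V - X - Y) + card (X - Y) * card (Y - X)
    \<le> card (edge_boundary V E X) + card (edge_boundary V (complement_edges V E) Y)"
proof -
  let ?E' = "complement_edges V E"
  note fin = finite_simple_graph_edges[OF G]
  have finc: "finite ?E'"
    by (rule finite_simple_graph_edges(2)[OF finite_simple_graph_complement[OF G]])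
  have finXY: "finite X" "finite Y" using fin(1) XV YV finite_subset by blast+
  let ?D = "(X \<inter> Y) \<times> (V - X - Y) \<union> (X - Y) \<times> (Y - X)"
  let ?f = "\<lambda>(x, y). {x, y}"
  have "card ?D = card ((X \<inter> Y) \<times> (V - X - Y)) + card ((X - Y) \<times> (Y - X))"
    using fin(1) finXY by (intro card_Un_disjoint) auto
  also have "\<dots> = card (X \<inter> Y) * card (V - X - Y) + card (X - Y) * card (Y - X)"
    by (simp add: card_cartesian_product)
  finally have D: "card ?D = \<dots>" .
  \<comment> \<open>The first component lies in \<open>X\<close> and the second outside it, so the
    unordered pair determines the ordered one.\<close>
  have "inj_on ?f ?D" by (auto simp: inj_on_def doubleton_eq_iff)
  then have "card ?D = card (?f ` ?D)" by (simp add: card_image)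
  also have "\<dots> \<le> card (edge_boundary V E X \<union> edge_boundary V ?E' Y)"
  proof (rule card_mono)
    show "finite (edge_boundary V E X \<union> edge_boundary V ?E' Y)"
      using fin(2) finc by (auto simp: edge_boundary_def)
    show "?f ` ?D \<subseteq> edge_boundary V E X \<union> edge_boundary V ?E' Y"
    proof
      fix e assume "e \<in> ?f ` ?D"
      then obtain x y where xy: "e = {x, y}" "x \<in> X" "y \<in> V - X" "x \<in> V"
        and Y: "(x \<in> Y \<and> y \<in> V - Y) \<or> (y \<in> Y \<and> x \<in> V - Y)"
        using XV YV by auto
      show "e \<in> edge_boundary V E X \<union> edge_boundary V ?E' Y"
      proof (cases "e \<in> E")
        case True
        then show ?thesis using xy by (auto simp: edge_boundary_def)
      next
        case False
        have "e \<in> ?E'" using False xy by (auto simp: complement_edges_def)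
        moreover have "\<exists>a\<in>Y. \<exists>b\<in>V - Y. e = {a, b}" using Y xy(1) by (metis insert_commute)
        ultimately show ?thesis by (auto simp: edge_boundary_def)
      qed
    qed
  qed
  also have "\<dots> \<le> card (edge_boundary V E X) + card (edge_boundary V ?E' Y)"
    by (rule card_Un_le)
  finally show ?thesis using D by simp
qed

text \<open>In the application \<open>p\<close>, \<open>a\<close>, \<open>c\<close> are the sizes of
  \<open>X \<inter> Y\<close>, \<open>X\<close>, \<open>Y\<close>, the term
  \<open>2 * m - a - c + p\<close> bounds the outer quadrant from below, and \<open>e\<close>,
  \<open>f\<close> are the boundary sizes. Integers avoid truncated subtraction.\<close>

lemma quadrant_inequality_int:
  fixes p a c m K e f :: int
  assumes a: "2 \<le> a" "a \<le> m" and c: "2 \<le> c" "c \<le> m" and p: "0 \<le> p"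
    and K: "p * (2 * m - a - c + p) + (a - p) * (c - p) \<le> e + f"
    and e: "(m - 1) * e < a * (a - 1)" and f: "(m - 1) * f < c * (c - 1)"
  shows "m = 2 \<or> (m = 3 \<and> a = 3 \<and> c = 3)"
proof (rule ccontr)
  assume neg: "\<not> ?thesis"
  then have m3: "m \<ge> 3" using a by linarith
  define L where "L = p * (2 * m - a - c + p) + (a - p) * (c - p)"
  have "(m - 1) * L \<le> (m - 1) * (e + f)"
    using K m3 by (intro mult_left_mono) (auto simp: L_def)
  \<comment> \<open>The 2 is gained from the strictness of the two integer inequalities
    \<open>e\<close> and \<open>f\<close>.\<close>
  then have up: "(m - 1) * L \<le> a * (a - 1) + c * (c - 1) - 2"
    using e f by (simp add: distrib_left)
  show False
  proof (cases "a + c \<le> m")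
    case True
    have "L = a * c + 2 * (p * p) + 2 * (p * (m - a - c))" by (simp add: L_def algebra_simps)
    moreover have "p * p \<ge> 0" "p * (m - a - c) \<ge> 0" using p True by auto
    ultimately have "L \<ge> a * c" by linarith
    then have "(m - 1) * L \<ge> (m - 1) * (a * c)" using m3 by (intro mult_left_mono) auto
    \<comment> \<open>With these bounds \<open>up\<close> would make
      \<open>(m - 1) * (a * c - a - c)\<close> negative, although
      \<open>(a - 1) * (c - 1) \<ge> 1\<close>.\<close>
    moreover have "a * (a - 1) \<le> a * (m - c - 1)" "c * (c - 1) \<le> c * (m - a - 1)"
      using True a c by (auto intro!: mult_left_mono)
    moreover have "(m - 1) * (a * c - a - c) \<ge> 0"
    proof -
      have "(a - 1) * (c - 1) \<ge> 1 * 1" using a c by (intro mult_mono) auto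
      then have "a * c - a - c \<ge> 0" by (simp add: algebra_simps)
      then show ?thesis using m3 by simp
    qed
    moreover have "a * c > 0" using a c by simp
    ultimately show False using up by (simp add: algebra_simps)
  next
    case False
    \<comment> \<open>In terms of the deficits \<open>x\<close> and \<open>y\<close>, completing the
      square eliminates \<open>p\<close>; both deficits lie between 0 and
      \<open>m - 2\<close>.\<close>
    define x y t where "x = m - a" and "y = m - c" and "t = x + y"
    have "2 * L = (2 * p + m - a - c)\<^sup>2 + (m\<^sup>2 - x\<^sup>2 - y\<^sup>2)"
      by (simp add: L_def x_def y_def power2_eq_square algebra_simps)
    then have "2 * L \<ge> m\<^sup>2 - x\<^sup>2 - y\<^sup>2" by simp
    moreover have "x\<^sup>2 + y\<^sup>2 \<le> (m - 2) * t"
    proof -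
      have "x * (m - 2 - x) \<ge> 0" "y * (m - 2 - y) \<ge> 0" using a c by (auto simp: x_def y_def)
      then show ?thesis by (simp add: t_def power2_eq_square algebra_simps)
    qed
    moreover define S where "S = x\<^sup>2 + y\<^sup>2"
    ultimately have S: "2 * L \<ge> m\<^sup>2 - S" "S \<le> (m - 2) * t" by auto
    have "a * (a - 1) + c * (c - 1) = 2 * m\<^sup>2 - 2 * m * t + S - 2 * m + t"
      by (simp add: S_def t_def x_def y_def power2_eq_square algebra_simps)
    moreover have "(m - 1) * (m\<^sup>2 - S) \<le> (m - 1) * (2 * L)"
      using S(1) m3 by (intro mult_left_mono) auto
    moreover have "(m + 1) * S \<le> (m + 1) * ((m - 2) * t)"
      using S(2) m3 by (intro mult_left_mono) auto
    \<comment> \<open>Eliminating \<open>L\<close> and \<open>S\<close> leaves an inequality linear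
      in \<open>t\<close>, to be refuted for \<open>0 \<le> t \<le> m - 1\<close>.\<close>
    ultimately have "m * (m - 1) * (m - 4) + 4 + t * (m * (5 - m)) \<le> 0"
      using up by (simp add: power2_eq_square algebra_simps)
    moreover have "m * (m - 1) * (m - 4) + 4 + t * (m * (5 - m)) > 0"
    proof -
      have t: "0 \<le> t" "t \<le> m - 1" using False a c by (auto simp: t_def x_def y_def)
      consider "m = 3" | "m = 4" | "m \<ge> 5" using m3 by linarith
      then show ?thesis
      proof cases
        case 1
        \<comment> \<open>For \<open>m = 3\<close>, the value \<open>t = 0\<close> is precisely the
          exception \<open>a = c = 3\<close>.\<close>
        then have "t \<noteq> 0" using neg a c by (auto simp: t_def x_def y_def)
        then show ?thesis using 1 t by simp
      next
        case 2
        then show ?thesis using t by simp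
      next
        case 3
        \<comment> \<open>The coefficient of \<open>t\<close> is now at most 0, so
          \<open>t = m - 1\<close> is the worst case, with value
          \<open>m * (m - 1) + 4\<close>.\<close>
        have "t * (m * (m - 5)) \<le> (m - 1) * (m * (m - 5))"
          using t 3 by (intro mult_right_mono) auto
        moreover have "m * m \<ge> m * 1" using m3 by (intro mult_left_mono) auto
        ultimately show ?thesis by (simp add: algebra_simps)
      qed
    qed
    ultimately show False by linarith
  qed
qed

text \<open>The integer estimate leaves two small cases, settled by enumerating the size
  \<open>p\<close> of the common quadrant.\<close>

lemma quadrant_inequality:
  fixes p q r s m e f :: nat
  assumes a: "2 \<le> p + q" "p + q \<le> m" and c: "2 \<le> p + r" "p + r \<le> m"
    and n: "2 * m \<le> p + q + r + s"
    and K: "p * s + q * r \<le> e + f"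
    and e: "(m - 1) * e < (p + q) * (p + q - 1)" and f: "(m - 1) * f < (p + r) * (p + r - 1)"
  shows "p + q + r + s = 4 \<and> m = 2 \<and> e = 1"
proof -
  have "int p * (2 * int m - int (p + q) - int (p + r) + int p) \<le> int p * int s"
    using n by (intro mult_left_mono) auto
  moreover have "int p * int s + int q * int r \<le> int e + int f"
    using K by (metis of_nat_add of_nat_le_iff of_nat_mult)
  ultimately have K': "int p * (2 * int m - int (p + q) - int (p + r) + int p) +
      (int (p + q) - int p) * (int (p + r) - int p) \<le> int e + int f"
    by simp
  have "int ((m - 1) * e) < int ((p + q) * (p + q - 1))" using e by (simp only: of_nat_less_iff)
  then have e': "(int m - 1) * int e < int (p + q) * (int (p + q) - 1)"
    using a by (simp add: of_nat_diff)
  have "int ((m - 1) * f) < int ((p + r) * (p + r - 1))" using f by (simp only: of_nat_less_iff)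
  then have f': "(int m - 1) * int f < int (p + r) * (int (p + r) - 1)"
    using a c by (simp add: of_nat_diff)
  have "int m = 2 \<or> (int m = 3 \<and> int (p + q) = 3 \<and> int (p + r) = 3)"
    by (rule quadrant_inequality_int[OF _ _ _ _ _ K' e' f']) (use a c in auto)
  then consider "m = 2" | "m = 3" "p + q = 3" "p + r = 3" by linarith
  then show ?thesis
  proof cases
    case 1
    then have "p + q = 2" "p + r = 2" using a c by auto
    then have ef: "e \<le> 1" "f \<le> 1" using e f 1 by auto
    have qr: "q = 2 - p" "r = 2 - p" "p = 0 \<or> p = 1 \<or> p = 2"
      using \<open>p + q = 2\<close> \<open>p + r = 2\<close> by linarith+
    \<comment> \<open>For \<open>p = 0\<close> and \<open>p = 2\<close> at least four opposite pairs
      exceed \<open>e + f \<le> 2\<close>; \<open>p = 1\<close> forces \<open>s = 1\<close> and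
      \<open>e = f = 1\<close>.\<close>
    then show ?thesis using K n 1 ef by (elim disjE) auto
  next
    case 2
    then have ef: "e \<le> 2" "f \<le> 2" using e f by auto
    have qr: "q = 3 - p" "r = 3 - p" "p = 0 \<or> p = 1 \<or> p = 2 \<or> p = 3" using 2 by linarith+
    \<comment> \<open>Every \<open>p\<close> yields at least five opposite pairs, against
      \<open>e + f \<le> 4\<close>.\<close>
    then show ?thesis using K n 2 ef by (elim disjE) auto
  qed
qed

text \<open>Both halves have volume above 2 but only one boundary edge, so each two-element half is
  itself an edge. The boundary edge joins them into the path \<open>u\<close>, \<open>v\<close>,
  \<open>w\<close>, \<open>z\<close>.\<close>

lemma single_boundary_edge_path4:
  assumes G: "finite_simple_graph V E" and XV: "X \<subseteq> V" and V4: "card V = 4" and X2: "card X = 2"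
    and b: "card (edge_boundary V E X) = 1" and vol: "2 < vol E X" "2 < vol E (V - X)"
  shows "graph_isomorphic V E (path_vertices 4) (path_edges 4)"
proof -
  note fin = finite_simple_graph_edges[OF G]
  have inner: "Z \<in> E" if "Z \<subseteq> V" "card Z = 2" "card (edge_boundary V E Z) = 1" "2 < vol E Z" for Z
  proof -
    have "{e \<in> E. e \<subseteq> Z} \<noteq> {}"
      using vol_eq[OF G that(1)] that(3,4) by (metis card.empty mult_0_right add_0 numeral_less_iff less_numeral_extra(3) not_numeral_less_one)
    then obtain e where "e \<in> E" "e \<subseteq> Z" by blast
    moreover have "finite Z" using fin(1) that(1) finite_subset by blast
    ultimately show ?thesis using fin(3) that(2) by (metis card_subset_eq)
  qed
  have X'2: "card (V - X) = 2"
    using XV V4 X2 fin(1) by (simp add: card_Diff_subset finite_subset)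
  obtain g where g: "edge_boundary V E X = {g}" using b card_1_singletonE by blast
  then have "g \<in> edge_boundary V E X" by simp
  then obtain v w where vw: "v \<in> X" "w \<in> V - X" "g = {v, w}" by (auto simp: edge_boundary_def)
  obtain u where u: "X = {u, v}" "u \<noteq> v"
    using X2 vw(1) by (auto simp: card_2_iff)
  have "card (V - X - {w}) = 1" using X'2 vw(2) by (simp only: card_Diff_singleton)
  then obtain z where "V - X - {w} = {z}" by (rule card_1_singletonE)
  then have z: "V - X = {w, z}" "z \<noteq> w" using vw(2) by blast+
  have V: "V = {u, v, w, z}" using XV u z by blast
  have dist: "u \<noteq> w" "u \<noteq> z" "v \<noteq> w" "v \<noteq> z" using u z by blast+
  have E1: "{u, v} \<in> E" using inner[OF XV X2 b vol(1)] u by simp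
  have "V - X \<in> E"
    using X'2 b vol(2) edge_boundary_Diff[OF XV, of E] by (intro inner) auto
  then have E3: "{w, z} \<in> E" using z by simp
  have E2: "{v, w} \<in> E"
    using \<open>g \<in> edge_boundary V E X\<close> vw(3) by (simp add: edge_boundary_def)
  have cross: "{x, y} = {v, w}" if "x \<in> X" "y \<in> V - X" "{x, y} \<in> E" for x y
  proof -
    have "{x, y} \<in> edge_boundary V E X" using that unfolding edge_boundary_def by blast
    then show ?thesis using g vw(3) by simp
  qed
  have N: "{u, w} \<notin> E" "{u, z} \<notin> E" "{v, z} \<notin> E"
    using cross[of u w] cross[of u z] cross[of v z] u z dist by (auto simp: doubleton_eq_iff)
  \<comment> \<open>\<open>graph_isomorphic\<close> also compares pairs with equal entries, which
    collapse to singletons.\<close>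
  have loop: "{x} \<notin> E" for x using fin(3)[of "{x}"] by auto
  define F where "F = (\<lambda>x. if x = u then 0 else if x = v then 1 else if x = w then 2 else 3 :: nat)"
  have F: "F u = 0" "F v = 1" "F w = 2" "F z = 3" using u z dist by (auto simp: F_def)
  have P: "path_edges 4 = {{0, 1}, {1, 2}, {2, 3}}"
  proof -
    have "path_edges 4 = (\<lambda>i. {i, Suc i}) ` {i. Suc i < 4}" unfolding path_edges_def by blast
    also have "{i. Suc i < 4} = {0, 1, 2}" by auto
    finally show ?thesis by (simp add: numeral_eq_Suc)
  qed
  have "path_vertices 4 = {0, 1, 2, 3}" by (auto simp: path_vertices_def)
  then have "bij_betw F V (path_vertices 4)"
    using u z dist F unfolding V bij_betw_def inj_on_def by auto
  moreover have "\<forall>x\<in>V. \<forall>y\<in>V. {x, y} \<in> E \<longleftrightarrow> {F x, F y} \<in> path_edges 4"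
    using E1 E2 E3 N loop unfolding V P
    by (auto simp: F doubleton_eq_iff insert_commute)
  ultimately show ?thesis unfolding graph_isomorphic_def by blast
qed

theorem theorem2p4:
  fixes V :: "'a set" and E :: "'a set set" and n :: nat
  assumes "finite_simple_graph V E"
    and "card V = n"
    and "n \<ge> 2"
    and "\<not> graph_isomorphic V E (path_vertices 4) (path_edges 4)"
  shows "max (cheeger_constant V E) (cheeger_constant V (complement_edges V E))
           \<ge> 1 / real_of_int \<lfloor>real n / 2\<rfloor>"
proof (rule ccontr)
  let ?E' = "complement_edges V E"
  define m where "m = n div 2"
  note G = assms(1)
  note G' = finite_simple_graph_complement[OF G]
  have finV: "finite V" using finite_simple_graph_edges(1)[OF G] .
  have "\<lfloor>real n / 2\<rfloor> = int m"
    using floor_divide_of_nat_eq[of n 2] by (simp add: m_def)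
  moreover assume "\<not> ?thesis"
  ultimately have less: "cheeger_constant V E < 1 / real m" "cheeger_constant V ?E' < 1 / real m"
    by auto
  have m: "m = card V div 2" "m \<ge> 1" "card V \<le> 2 * m + 1" using assms(2,3) by (auto simp: m_def)
  then have mpos: "m > 0" by simp
  \<comment> \<open>An edgeless graph has constant 0 and yields no information here, so the argument
    uses whichever of the graph and its complement has an edge: it provides a set of size between 2
    and \<open>m\<close>.\<close>
  have m2: "m \<ge> 2"
  proof -
    obtain u v where uv: "u \<in> V" "v \<in> V" "u \<noteq> v"
      using assms(2,3) finV by (metis card_le_Suc0_iff_eq not_less_eq_eq numeral_2_eq_2)
    have "2 \<le> m" if H: "finite_simple_graph V H" "H \<noteq> {}" "cheeger_constant V H < 1 / real m" for H
    proof -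
      obtain X where X: "X \<subseteq> V" "card X \<le> m" "m * card (edge_boundary V H X) < vol H X"
        using cheeger_constant_less_obtains[OF H mpos m(3)] by blast
      then show ?thesis using small_boundary_bound(1)[OF H(1) X(1) mpos X(3)] by simp
    qed
    moreover have "E \<noteq> {} \<or> ?E' \<noteq> {}" using uv by (auto simp: complement_edges_def)
    ultimately show ?thesis using G G' less by blast
  qed
  obtain X where X: "X \<subseteq> V" "2 \<le> card X" "card X \<le> m"
    "(m - 1) * card (edge_boundary V E X) < card X * (card X - 1)"
    "card (edge_boundary V E X) > 0 \<Longrightarrow>
       m * card (edge_boundary V E X) < vol E X \<and> m * card (edge_boundary V E X) < vol E (V - X)"
    using small_cheeger_constant_obtains[OF G less(1) m(1) m2] by blast
  obtain Y where Y: "Y \<subseteq> V" "2 \<le> card Y" "card Y \<le> m"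
    "(m - 1) * card (edge_boundary V ?E' Y) < card Y * (card Y - 1)"
    using small_cheeger_constant_obtains[OF G' less(2) m(1) m2] by blast
  have finXY: "finite X" "finite Y" using finV X(1) Y(1) finite_subset by blast+
  have cX: "card X = card (X \<inter> Y) + card (X - Y)"
    using finXY by (metis card_Int_Diff)
  have cY: "card Y = card (X \<inter> Y) + card (Y - X)"
    using finXY by (metis card_Int_Diff inf_commute)
  have "card V = card X + card (V - X)"
    using finV X(1) by (metis card_Int_Diff inf.absorb_iff2)
  moreover have "card (V - X) = card ((V - X) \<inter> Y) + card (V - X - Y)"
    using finV by (metis card_Int_Diff finite_Diff)
  moreover have "(V - X) \<inter> Y = Y - X" using Y(1) by blast
  ultimately have cV: "card V = card (X \<inter> Y) + card (X - Y) + card (Y - X) + card (V - X - Y)"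
    using cX by simp
  have "2 * m \<le> card V" using m(1) by simp
  then have "card V = 4 \<and> m = 2 \<and> card (edge_boundary V E X) = 1"
    using quadrant_inequality[OF _ _ _ _ _ opposite_quadrants_le[OF G X(1) Y(1)], of m]
      X(2-4) Y(2-4) unfolding cX cY cV by blast
  \<comment> \<open>As the boundary of \<open>X\<close> is nonempty, the conditional conclusion in
    \<open>X(5)\<close> applies and puts both volumes above \<open>m * 1 = 2\<close>.\<close>
  then show False
    using single_boundary_edge_path4[OF G X(1)] X(2,3,5) assms(4) by simp
qed

end
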